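(* Let $G,I,J,L,M,N,P,Q,R,S$ be complex numbers and put $$\begin{aligned} A&=I+2L+2N+P+2Q+6R+4S-14,\\ D&=-G-I-J-2L-M-2P-3Q-6R-7S+20,\\ E&=-I-2L-N-Q-3R-S+5,\\ F&=-3G-6I-7J-7M+6N-12L-9P-15Q-24R-33S+90,\\ H&=-L-2N-P-Q-4R-3S+10,\\ K&=2I+2J-2N+4L-P+4Q+6R+2S-10, \end{aligned}$$ and assume $D\ne0$. Then for every integer $n\ge0$, $$\begin{aligned} D\,t_n^{4}&=\sum_{k_1+\cdots+k_5=n}\binom{n}{k_1,\dots,k_5}T_{k_1}\cdots T_{k_5}\\ &\quad-\frac{A}{563^2}5^nX_n-\frac{E}{563^2}\sum_{k=0}^n\binom nk4^{n-k}W_{n-k}T_k+\frac{F}{563}\sum_{k=0}^n\binom nkT_k\\ &\quad-G\sum_{k=0}^n\binom nkt_k^{1}T_{n-k}-\frac{H}{563^2}\sum_{k=0}^n\binom nk3^{n-k}2^kV_{n-k}U_k-\frac{I}{563}\sum_{k=0}^n\binom nk3^kV_kt_{n-k}\\ &\quad+\frac{J}{563^2}\sum_{k_1+k_2+k_3=n}\binom{n}{k_1,k_2,k_3}(-1)^{k_1}2^{k_2}Y_{k_1}U_{k_2}\\ &\quad+\frac{K}{563}\sum_{k_1+k_2+k_3=n}\binom{n}{k_1,k_2,k_3}(-1)^{k_1}Y_{k_1}t_{k_2}\\ &\quad-\frac{L}{563}\sum_{k_1+k_2+k_3=n}\binom{n}{k_1,k_2,k_3}3^{k_1}V_{k_1}T_{k_2}T_{k_3}\\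 &\quad+\frac{M}{563}\sum_{k_1+k_2+k_3+k_4=n}\binom{n}{k_1,k_2,k_3,k_4}(-1)^{k_1}Y_{k_1}T_{k_2}T_{k_3}\\ &\quad-\frac{N}{563^2}\sum_{k_1+k_2+k_3=n}\binom{n}{k_1,k_2,k_3}2^{k_1}U_{k_1}2^{k_2}U_{k_2}T_{k_3}\\ &\quad-P\sum_{k_1+k_2+k_3=n}\binom{n}{k_1,k_2,k_3}t_{k_1}t_{k_2}T_{k_3}\\ &\quad-\frac{Q}{563}\sum_{k_1+k_2+k_3=n}\binom{n}{k_1,k_2,k_3}2^{k_1}U_{k_1}t_{k_2}T_{k_3}\\ &\quad-\frac{R}{563}\sum_{k_1+k_2+k_3+k_4=n}\binom{n}{k_1,k_2,k_3,k_4}2^{k_1}U_{k_1}T_{k_2}T_{k_3}T_{k_4}\\ &\quad-S\sum_{k_1+k_2+k_3+k_4=n}\binom{n}{k_1,k_2,k_3,k_4}t_{k_1}T_{k_2}T_{k_3}T_{k_4}. \end{aligned}$$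
   Context: For given $s_0,s_1,s_2,s_3$, the sequence $T_n^{(s_0,s_1,s_2,s_3)}$ is defined by $T_j^{(s_0,s_1,s_2,s_3)}=s_j$ for $0\le j\le 3$ and, for $n\ge4$, each term being the sum of the four preceding terms. The Tetranacci numbers are $T_n=T_n^{(0,1,1,2)}$. Abbreviate $U_n=T_n^{(40,64,215,344)}$, $V_n=T_n^{(15,27,48,107)}$, $W_n=T_n^{(3052,4658,8804,16451)}$, $X_n=T_n^{(500,1423,2598,4986)}$, $Y_n=T_n^{(-5,2,13,32)}$, and $$t_n=\frac12\left(\sum_{k=0}^n\binom nkT_kT_{n-k}-\frac{2^n}{563}U_n\right).$$ All indices $k_i$ in sums run over nonnegative integers and $\binom{n}{k_1,\dots,k_r}=\frac{n!}{k_1!\cdots k_r!}$. Let $\lambda_1,\lambda_2,\lambda_3,\lambda_4$ be the (distinct, complex) roots of $x^4-x^3-x^2-x-1=0$ and $c_i=\frac1{-\lambda_i^3+6\lambda_i-1}$ (so $\sum_{n\ge0}T_n\frac{x^n}{n!}=\sum_{i=1}^4c_ie^{\lambda_ix}$). The numbers $t_n^1$, $t_n^4$ (superscripts are indices, not powers) are defined by $$\sum_{n=0}^\infty t_n^{1}\frac{x^n}{n!}=\sum_{1\le i<j<l\le4}c_ic_jc_le^{(\lambda_i+\lambda_j+\lambda_l)x}\left(c_ie^{\lambda_ix}+c_je^{\lambda_jx}+c_le^{\lambda_lx}\right),$$ $$\sum_{n=0}^\infty t_n^{4}\frac{x^n}{n!}=\sum_{1\le i<j<l\le4}c_ic_jc_le^{(\lambda_i+\lambda_j+\lambda_l)x}\left(c_ie^{\lambda_ix}+c_je^{\lambda_jx}+c_le^{\lambda_lx}\right)^2.$$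 *)

theory Defs
  imports
    "HOL-Computational_Algebra.Formal_Power_Series"
    "HOL-Computational_Algebra.Fundamental_Theorem_Algebra"
begin

fun tetra :: "complex \<Rightarrow> complex \<Rightarrow> complex \<Rightarrow> complex \<Rightarrow> nat \<Rightarrow> complex" where
  "tetra s0 s1 s2 s3 0 = s0"
| "tetra s0 s1 s2 s3 (Suc 0) = s1"
| "tetra s0 s1 s2 s3 (Suc (Suc 0)) = s2"
| "tetra s0 s1 s2 s3 (Suc (Suc (Suc 0))) = s3"
| "tetra s0 s1 s2 s3 (Suc (Suc (Suc (Suc n)))) =
     tetra s0 s1 s2 s3 (Suc (Suc (Suc n))) + tetra s0 s1 s2 s3 (Suc (Suc n))
     + tetra s0 s1 s2 s3 (Suc n) + tetra s0 s1 s2 s3 n"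

abbreviation tetT :: "nat \<Rightarrow> complex" where "tetT \<equiv> tetra 0 1 1 2"
abbreviation tetU :: "nat \<Rightarrow> complex" where "tetU \<equiv> tetra 40 64 215 344"
abbreviation tetV :: "nat \<Rightarrow> complex" where "tetV \<equiv> tetra 15 27 48 107"
abbreviation tetW :: "nat \<Rightarrow> complex" where "tetW \<equiv> tetra 3052 4658 8804 16451"
abbreviation tetX :: "nat \<Rightarrow> complex" where "tetX \<equiv> tetra 500 1423 2598 4986"
abbreviation tetY :: "nat \<Rightarrow> complex" where "tetY \<equiv> tetra (-5) 2 13 32"

definition small_t :: "nat \<Rightarrow> complex" where
  "small_t n = 1/2 * ((\<Sum>k=0..n. of_nat (n choose k) * tetT k * tetT (n - k)) - 2^n / 563 * tetU n)"

definition multinom :: "nat \<Rightarrow> nat list \<Rightarrow> complex" where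
  "multinom n ks = fact n / (\<Prod>k\<leftarrow>ks. fact k)"

definition tetra_roots :: "complex set" where
  "tetra_roots = {x. x^4 - x^3 - x^2 - x - 1 = 0}"

definition tetra_coeff :: "complex \<Rightarrow> complex" where
  "tetra_coeff x = 1 / (- (x^3) + 6 * x - 1)"

definition egf :: "(nat \<Rightarrow> complex) \<Rightarrow> complex fps" where
  "egf a = Abs_fps (\<lambda>n. a n / fact n)"

text \<open>The series \<open>\<Sum> c\<^sub>i c\<^sub>j c\<^sub>l exp((\<lambda>\<^sub>i+\<lambda>\<^sub>j+\<lambda>\<^sub>l)x) (c\<^sub>i exp(\<lambda>\<^sub>i x) + c\<^sub>j exp(\<lambda>\<^sub>j x) + c\<^sub>l exp(\<lambda>\<^sub>l x))\<^sup>p\<close>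
  over \<open>1 \<le> i < j < l \<le> 4\<close>, where \<open>lam\<close> enumerates the roots; \<open>fps_exp a\<close> is the formal series of \<open>exp(a x)\<close>.\<close>

definition triple_series :: "(nat \<Rightarrow> complex) \<Rightarrow> nat \<Rightarrow> complex fps" where
  "triple_series lam p =
     (let c = (\<lambda>i. tetra_coeff (lam i)) in
      \<Sum>(i, j, l) \<in> {(i, j, l). 1 \<le> i \<and> i < j \<and> j < l \<and> l \<le> (4::nat)}.
        fps_const (c i * c j * c l) * fps_exp (lam i + lam j + lam l)
        * (fps_const (c i) * fps_exp (lam i) + fps_const (c j) * fps_exp (lam j)
           + fps_const (c l) * fps_exp (lam l)) ^ p)"

definition t_one :: "(nat \<Rightarrow> complex) \<Rightarrow> nat \<Rightarrow> complex" where
  "t_one lam n = fact n * fps_nth (triple_series lam 1) n"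

definition t_four :: "(nat \<Rightarrow> complex) \<Rightarrow> nat \<Rightarrow> complex" where
  "t_four lam n = fact n * fps_nth (triple_series lam 2) n"

lemma egf_t_one: "egf (t_one lam) = triple_series lam 1"
  and egf_t_four: "egf (t_four lam) = triple_series lam 2"
  by (simp_all add: fps_eq_iff egf_def t_one_def t_four_def)

text \<open>The four roots are indeed distinct, so an enumeration of them by \<open>{1..4}\<close> exists.\<close>

lemma tetra_roots_enumeration: "\<exists>lam. bij_betw lam {1..4::nat} tetra_roots"
proof -
  define p :: "complex poly" where "p = [:-1, -1, -1, -1, 1:]"
  have dp: "pderiv p = [:-1, -2, -3, 4:]"
    by (simp add: p_def pderiv_pCons)
  have roots: "{x. poly p x = 0} = tetra_roots"
    by (auto simp: p_def tetra_roots_def algebra_simps power2_eq_square power3_eq_cube power4_eq_xxxx)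
  have "False" if "poly p a = 0" "poly (pderiv p) a = 0" for a
  proof -
    have "(-573 + 396 * a - 64 * a^2) * poly p a + (10 + 157 * a - 103 * a^2 + 16 * a^3) * poly (pderiv p) a = 563"
      unfolding dp by (simp add: p_def algebra_simps power2_eq_square power3_eq_cube)
    with that show False by simp
  qed
  hence "rsquarefree p"
    by (auto simp: rsquarefree_roots)
  hence "p = (\<Prod>z\<in>tetra_roots. [:-z, 1:])"
    using complex_poly_decompose_rsquarefree[of p] unfolding roots by (simp add: p_def)
  moreover have "degree (\<Prod>z\<in>tetra_roots. [:-z, 1:]) = card tetra_roots"
    by (subst degree_prod_eq_sum_degree) auto
  moreover have "degree p = 4"
    by (simp add: p_def)
  ultimately have c: "card tetra_roots = 4"
    by metis
  hence "finite tetra_roots"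
    by (simp add: card_ge_0_finite)
  thus ?thesis
    using ex_bij_betw_nat_finite_1[of tetra_roots] c by auto
qed

end

theory Submission
  imports Defs
begin

text \<open>Write \<open>y\<^sub>i = c\<^sub>i exp (\<lambda>\<^sub>i x)\<close> for the four summands of the exponential generating function of \<open>T\<close>, with
  power sums \<open>p\<^sub>k\<close> and elementary symmetric functions \<open>e\<^sub>k\<close>. Every sum in the theorem has a symmetric
  function of the \<open>y\<^sub>i\<close> as its generating function. The series of \<open>T\<close> is \<open>p\<^sub>1 = e\<^sub>1\<close>, and since the
  sequences \<open>U, V, W, X\<close> are \<open>\<Sum> c\<^sub>i\<^sup>k \<lambda>\<^sub>i\<^sup>n\<close> for \<open>k = 2, 3, 4, 5\<close> up to a factor \<open>563\<close> or \<open>563\<^sup>2\<close>,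
  the series of \<open>2\<^sup>n U\<^sub>n, \<dots>, 5\<^sup>n X\<^sub>n\<close> are multiples of \<open>p\<^sub>2, \<dots>, p\<^sub>5\<close>
  (\<open>egf_power_sums\<close>); Newton's formula \<open>2 e\<^sub>2 = p\<^sub>1\<^sup>2 - p\<^sub>2\<close> makes \<open>e\<^sub>2\<close> the series of \<open>t\<close>
  (\<open>egf_small_t\<close>).

  The number \<open>563\<close> enters through \<open>c\<^sub>1 c\<^sub>2 c\<^sub>3 c\<^sub>4 = -1/563\<close>. As the roots sum to \<open>1\<close>, this gives
  \<open>e\<^sub>4 = - exp x / 563\<close> (\<open>mode_product\<close>), and then \<open>e\<^sub>3 = e\<^sub>4 \<Sum> 1/y\<^sub>i\<close>, where the weights of
  \<open>1/y\<^sub>i = (-\<lambda>\<^sub>i\<^sup>3 + 6\<lambda>\<^sub>i - 1) exp (-\<lambda>\<^sub>i x)\<close> produce the sequence \<open>Y\<close> (\<open>egf_triple_products\<close>). This explains why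
  the multinomial sums involving \<open>Y\<close>, and the sum of \<open>binom n k T\<^sub>k\<close>, contain one more index than
  factors: the free index stands for \<open>exp x\<close>.

  A product of generating functions turns into a multinomial sum (\<open>egf_nth_binomial\<close>,
  \<open>egf_nth_multinomial\<close>), so the theorem is the coefficient of an identity between symmetric functions of
  degree five in four variables. These form a six-dimensional space, spanned by the series of \<open>t\<^sup>4\<close> and
  \<open>p\<^sub>5, p\<^sub>4 e\<^sub>1, e\<^sub>4 e\<^sub>1, p\<^sub>3 p\<^sub>2, e\<^sub>3 e\<^sub>2\<close>. Expanding the eleven other products in this basis
  (\<open>quintic_symmetric_identities\<close>) gives one relation for \<open>p\<^sub>1\<^sup>5\<close> and one for each of the ten free parameters;
  the constants \<open>D, A, E, F, H, K\<close> collect the basis coefficients in their linear combination.\<close>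

section \<open>Power sums over the roots\<close>

lemma tetra_recurrence:
  assumes rec: "\<And>n. f (n + 4) = f (n + 3) + f (n + 2) + f (n + 1) + f n"
  shows "f n = tetra (f 0) (f 1) (f 2) (f 3) n"
proof -
  have "f n = tetra s0 s1 s2 s3 n" if "s0 = f 0" "s1 = f 1" "s2 = f 2" "s3 = f 3" for s0 s1 s2 s3
    using that
  proof (induction s0 s1 s2 s3 n rule: tetra.induct)
    case (5 s0 s1 s2 s3 n)
    then show ?case using rec[of n] by (simp add: eval_nat_numeral)
  qed (simp_all add: eval_nat_numeral)
  then show ?thesis by blast
qed

lemma root_power4:
  "x \<in> tetra_roots \<Longrightarrow> x ^ 4 = x ^ 3 + x ^ 2 + x + 1"
  by (simp add: tetra_roots_def algebra_simps)

text \<open>Weighted power sums of the roots satisfy the recurrence term by term, so their first four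
  values determine them.\<close>

lemma sum_root_powers_tetra:
  fixes w :: "complex \<Rightarrow> complex"
  defines "f \<equiv> (\<lambda>n. \<Sum>x\<in>tetra_roots. w x * x ^ n)"
  shows "f n = tetra (f 0) (f 1) (f 2) (f 3) n"
proof (rule tetra_recurrence)
  fix n
  have "w x * x ^ (n + 4) = w x * x ^ (n + 3) + w x * x ^ (n + 2) + w x * x ^ (n + 1) + w x * x ^ n"
    if "x \<in> tetra_roots" for x
    unfolding power_add root_power4[OF that] distrib_left power_one_right mult_1_right
    by (simp only: ac_simps)
  then show "f (n + 4) = f (n + 3) + f (n + 2) + f (n + 1) + f n"
    unfolding f_def sum.distrib[symmetric] by (intro sum.cong) auto
qed

lemma sum_tetra_roots:
  fixes f :: "complex \<Rightarrow> 'a::comm_monoid_add"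
  assumes "bij_betw lam {1..4::nat} tetra_roots"
  shows "(\<Sum>x\<in>tetra_roots. f x) = f (lam 1) + f (lam 2) + f (lam 3) + f (lam 4)"
proof -
  have "{1..4::nat} = {1, 2, 3, 4}" by auto
  then show ?thesis
    by (simp add: sum.reindex_bij_betw[OF assms, symmetric] add.assoc)
qed

text \<open>Divided differences of the polynomial at two, three and four distinct roots vanish. In order of
  decreasing number of points they are linear in the next elementary symmetric function, so they yield
  the three values one after the other.\<close>

lemma roots_vieta:
  assumes "bij_betw lam {1..4::nat} tetra_roots"
  defines "a \<equiv> lam 1" and "b \<equiv> lam 2" and "c \<equiv> lam 3" and "d \<equiv> lam 4"
  shows "a + b + c + d = 1"
    and "a*b + a*c + a*d + b*c + b*d + c*d = -1"
    and "a*b*c + a*b*d + a*c*d + b*c*d = 1"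
proof -
  have inj: "lam i \<noteq> lam j" if "i \<in> {1..4}" "j \<in> {1..4}" "i \<noteq> j" for i j
    using assms(1) that by (auto simp: bij_betw_def inj_on_def)
  have root: "lam i ^ 4 = lam i ^ 3 + lam i ^ 2 + lam i + 1" if "i \<in> {1..4}" for i
    using assms(1) that by (auto simp: bij_betw_def intro!: root_power4)
  have r: "a^4 = a^3 + a^2 + a + 1" "b^4 = b^3 + b^2 + b + 1" "c^4 = c^3 + c^2 + c + 1" "d^4 = d^3 + d^2 + d + 1"
    unfolding a_def b_def c_def d_def by (rule root, simp)+
  have ne: "a \<noteq> b" "a \<noteq> c" "a \<noteq> d" "b \<noteq> c" "b \<noteq> d" "c \<noteq> d"
    unfolding a_def b_def c_def d_def by (simp_all add: inj del: One_nat_def)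
  have dd1: "x^3 + x^2*y + x*y^2 + y^3 = x^2 + x*y + y^2 + x + y + 1"
    if "x^4 = x^3 + x^2 + x + 1" "y^4 = y^3 + y^2 + y + 1" "x \<noteq> y" for x y :: complex
  proof -
    have "(x - y) * (x^3 + x^2*y + x*y^2 + y^3 - (x^2 + x*y + y^2 + x + y + 1)) = 0"
      using that(1,2) by algebra
    then show ?thesis using that(3) by simp
  qed
  have dd2: "x^2 + y^2 + z^2 + x*y + x*z + y*z = x + y + z + 1"
    if "x^4 = x^3 + x^2 + x + 1" "y^4 = y^3 + y^2 + y + 1" "z^4 = z^3 + z^2 + z + 1"
       "x \<noteq> y" "x \<noteq> z" "y \<noteq> z" for x y z :: complex
  proof -
    have "(y - z) * (x^2 + y^2 + z^2 + x*y + x*z + y*z - (x + y + z + 1)) = 0"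
      using dd1[of x y] dd1[of x z] that by algebra
    then show ?thesis using that(6) by simp
  qed
  note abc = dd2[OF r(1-3) ne(1,2,4)] and abd = dd2[OF r(1,2,4) ne(1,3,5)]
  have "(c - d) * (a + b + c + d - 1) = 0"
    using abc abd by algebra
  then show e1: "a + b + c + d = 1" using ne by simp
  show e2: "a*b + a*c + a*d + b*c + b*d + c*d = -1"
    using abc e1 by algebra
  show e3: "a*b*c + a*b*d + a*c*d + b*c*d = 1"
    using dd1[OF r(1,2) ne(1)] e1 e2 by algebra
qed

lemma root_power_sums:
  assumes "bij_betw lam {1..4::nat} tetra_roots"
  shows "(\<Sum>x\<in>tetra_roots. x ^ n) = tetra 4 1 3 7 n"
proof -
  note v = roots_vieta[OF assms]
  have "(\<Sum>x\<in>tetra_roots. x ^ 1) = 1"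
    using v(1) by (simp add: sum_tetra_roots[OF assms])
  moreover have "(\<Sum>x\<in>tetra_roots. x ^ 2) = 3"
    unfolding sum_tetra_roots[OF assms] using v by algebra
  moreover have "(\<Sum>x\<in>tetra_roots. x ^ 3) = 7"
    unfolding sum_tetra_roots[OF assms] using v by algebra
  moreover have "(\<Sum>x\<in>tetra_roots. x ^ 0) = 4"
    unfolding sum_tetra_roots[OF assms] by simp
  ultimately show ?thesis
    using sum_root_powers_tetra[of "\<lambda>_. 1" n] by simp
qed

text \<open>Modulo the quartic, every polynomial weight in a root reduces to a cubic one. The
  premises on \<open>s0, \<dots>, s3\<close> evaluate the first four sums by means of the power sums
  \<open>4, 1, 3, 7, 15, 26, 51\<close> of the roots. The separate denominator \<open>N\<close> admits weights with
  fractional coefficients.\<close>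

lemma sum_cubic_weight_tetra:
  fixes a0 a1 a2 a3 N :: complex
  assumes lam: "bij_betw lam {1..4::nat} tetra_roots"
    and w: "\<And>x. x \<in> tetra_roots \<Longrightarrow> w x = (a0 + a1*x + a2*x^2 + a3*x^3) / N"
    and s: "N * s0 = 4*a0 + a1 + 3*a2 + 7*a3" "N * s1 = a0 + 3*a1 + 7*a2 + 15*a3"
      "N * s2 = 3*a0 + 7*a1 + 15*a2 + 26*a3" "N * s3 = 7*a0 + 15*a1 + 26*a2 + 51*a3"
    and N: "N \<noteq> 0"
  shows "(\<Sum>x\<in>tetra_roots. w x * x ^ n) = tetra s0 s1 s2 s3 n"
proof -
  \<comment> \<open>the power sums of the roots up to order six\<close>
  have P: "tetra 4 1 3 7 4 = 15" "tetra 4 1 3 7 5 = 26" "tetra 4 1 3 7 6 = 51"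
    "tetra 4 1 3 7 1 = 1" "tetra 4 1 3 7 2 = 3" "tetra 4 1 3 7 3 = 7"
    by (simp_all add: eval_nat_numeral)
  have sum: "(\<Sum>x\<in>tetra_roots. w x * x ^ m) =
      (a0 * tetra 4 1 3 7 m + a1 * tetra 4 1 3 7 (m + 1) + a2 * tetra 4 1 3 7 (m + 2)
        + a3 * tetra 4 1 3 7 (m + 3)) / N" for m
    unfolding root_power_sums[OF lam, symmetric] sum_distrib_left sum.distrib[symmetric] sum_divide_distrib
    by (intro sum.cong refl, simp only: w times_divide_eq_left power_add power_one_right distrib_right)
      (simp only: ac_simps)
  have "(\<Sum>x\<in>tetra_roots. w x * x ^ 0) = N * s0 / N" "(\<Sum>x\<in>tetra_roots. w x * x ^ 1) = N * s1 / N"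
    "(\<Sum>x\<in>tetra_roots. w x * x ^ 2) = N * s2 / N" "(\<Sum>x\<in>tetra_roots. w x * x ^ 3) = N * s3 / N"
    unfolding sum s by (simp_all add: P mult.commute)
  then show ?thesis
    unfolding sum_root_powers_tetra[of w n] using N by simp
qed

section \<open>The coefficients\<close>

text \<open>Each coefficient is the reciprocal of a cubic in its root; the cubic that inverts it modulo
  the quartic comes from the extended Euclidean algorithm.\<close>

lemma coeff_inverse:
  assumes "x \<in> tetra_roots"
  shows "tetra_coeff x * (- (x^3) + 6*x - 1) = 1"
    and "tetra_coeff x = (-87 - 71*x - 61*x^2 + 86*x^3) / 563"
proof -
  have *: "(- (x^3) + 6*x - 1) * (-87 - 71*x - 61*x^2 + 86*x^3) = 563"
    using root_power4[OF assms] by algebra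
  then have nz: "- (x^3) + 6*x - 1 \<noteq> 0" by auto
  show "tetra_coeff x * (- (x^3) + 6*x - 1) = 1"
    using nz by (simp add: tetra_coeff_def)
  show "tetra_coeff x = (-87 - 71*x - 61*x^2 + 86*x^3) / 563"
    using * nz by (simp add: tetra_coeff_def divide_eq_eq eq_divide_eq mult.commute)
qed

text \<open>The successive powers of the cubic in \<open>coeff_inverse\<close>, reduced modulo the quartic. The
  denominators are smaller than the exponent suggests because \<open>563\<close> divides out.\<close>

lemma coeff_powers:
  assumes "x \<in> tetra_roots"
  shows "tetra_coeff x ^ 2 = (6 + 9*x + 28*x^2 - 11*x^3) / 563"
    and "tetra_coeff x ^ 3 = (512 + 1958*x - 1220*x^2 + 1157*x^3) / 563^2"
    and "tetra_coeff x ^ 4 = (248 - 175*x + 255*x^2 + 210*x^3) / 563^2"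
    and "tetra_coeff x ^ 5 = (-21851 + 24522*x + 20077*x^2 + 40593*x^3) / 563^3"
proof -
  note r = root_power4[OF assms]
  have c1: "563 * tetra_coeff x = -87 - 71*x - 61*x^2 + 86*x^3"
    by (simp add: coeff_inverse(2)[OF assms])
  have c2: "563 * tetra_coeff x ^ 2 = 6 + 9*x + 28*x^2 - 11*x^3"
  proof -
    have "563 * (563 * tetra_coeff x ^ 2) = (563 * tetra_coeff x) ^ 2" by (simp add: power2_eq_square)
    also have "\<dots> = 563 * (6 + 9*x + 28*x^2 - 11*x^3)" unfolding c1 using r by algebra
    finally show ?thesis by (simp only: mult_cancel_left) simp
  qed
  have c3: "563^2 * tetra_coeff x ^ 3 = 512 + 1958*x - 1220*x^2 + 1157*x^3"
    using c1 c2 r by algebra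
  have c4: "563^2 * tetra_coeff x ^ 4 = 248 - 175*x + 255*x^2 + 210*x^3"
    using c2 r by algebra
  have c5: "563^3 * tetra_coeff x ^ 5 = -21851 + 24522*x + 20077*x^2 + 40593*x^3"
    using c1 c4 r by algebra
  show "tetra_coeff x ^ 2 = (6 + 9*x + 28*x^2 - 11*x^3) / 563"
    "tetra_coeff x ^ 3 = (512 + 1958*x - 1220*x^2 + 1157*x^3) / 563^2"
    "tetra_coeff x ^ 4 = (248 - 175*x + 255*x^2 + 210*x^3) / 563^2"
    "tetra_coeff x ^ 5 = (-21851 + 24522*x + 20077*x^2 + 40593*x^3) / 563^3"
    unfolding c2[symmetric] c3[symmetric] c4[symmetric] c5[symmetric] by simp_all
qed

lemma coeff_power_sums:
  assumes lam: "bij_betw lam {1..4::nat} tetra_roots"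
  shows "(\<Sum>x\<in>tetra_roots. tetra_coeff x * x ^ n) = tetT n"
    and "(\<Sum>x\<in>tetra_roots. 563 * tetra_coeff x ^ 2 * x ^ n) = tetU n"
    and "(\<Sum>x\<in>tetra_roots. 563 * tetra_coeff x ^ 3 * x ^ n) = tetV n"
    and "(\<Sum>x\<in>tetra_roots. 563^2 * tetra_coeff x ^ 4 * x ^ n) = tetW n"
    and "(\<Sum>x\<in>tetra_roots. 563^2 * tetra_coeff x ^ 5 * x ^ n) = tetX n"
    and "(\<Sum>x\<in>tetra_roots. (- (x^3) + 6*x - 1) * x ^ n) = tetY n"
proof -
  note W = sum_cubic_weight_tetra[OF lam]
  show "(\<Sum>x\<in>tetra_roots. tetra_coeff x * x ^ n) = tetT n"
    by (rule W[where ?a0.0 = "-87" and ?a1.0 = "-71" and ?a2.0 = "-61" and ?a3.0 = 86 and N = 563])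
      (simp_all add: coeff_inverse(2))
  show "(\<Sum>x\<in>tetra_roots. 563 * tetra_coeff x ^ 2 * x ^ n) = tetU n"
    by (rule W[where ?a0.0 = 6 and ?a1.0 = 9 and ?a2.0 = 28 and ?a3.0 = "-11" and N = 1])
      (simp_all add: coeff_powers)
  show "(\<Sum>x\<in>tetra_roots. 563 * tetra_coeff x ^ 3 * x ^ n) = tetV n"
    by (rule W[where ?a0.0 = 512 and ?a1.0 = 1958 and ?a2.0 = "-1220" and ?a3.0 = 1157 and N = 563])
      (simp_all add: coeff_powers)
  show "(\<Sum>x\<in>tetra_roots. 563^2 * tetra_coeff x ^ 4 * x ^ n) = tetW n"
    by (rule W[where ?a0.0 = 248 and ?a1.0 = "-175" and ?a2.0 = 255 and ?a3.0 = 210 and N = 1])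
      (simp_all add: coeff_powers)
  show "(\<Sum>x\<in>tetra_roots. 563^2 * tetra_coeff x ^ 5 * x ^ n) = tetX n"
    by (rule W[where ?a0.0 = "-21851" and ?a1.0 = 24522 and ?a2.0 = 20077 and ?a3.0 = 40593 and N = 563])
      (simp_all add: coeff_powers)
  show "(\<Sum>x\<in>tetra_roots. (- (x^3) + 6*x - 1) * x ^ n) = tetY n"
    by (rule W[where ?a0.0 = "-1" and ?a1.0 = 6 and ?a2.0 = 0 and ?a3.0 = "-1" and N = 1])
      (simp_all add: algebra_simps)
qed

text \<open>Computed through the reciprocals: their power sums of orders one to four follow from the
  reduction modulo the quartic, and Newton's formula turns these into the product \<open>-563\<close>.\<close>

lemma coeff_product:
  assumes lam: "bij_betw lam {1..4::nat} tetra_roots"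
  shows "tetra_coeff (lam 1) * tetra_coeff (lam 2) * tetra_coeff (lam 3) * tetra_coeff (lam 4) = -1/563"
proof -
  define g where "g x = - (x^3) + 6*x - 1" for x :: complex
  have root: "lam i \<in> tetra_roots" if "i \<in> {1..4}" for i
    using lam that by (auto simp: bij_betw_def)
  note W = sum_cubic_weight_tetra[OF lam, where n = 0 and N = 1]
  have g2: "g x ^ 2 = -9 - 21*x + 28*x^2 - 6*x^3"
    and g3: "g x ^ 3 = -22 - 86*x - 201*x^2 + 136*x^3"
    and g4: "g x ^ 4 = 853 + 850*x + 445*x^2 - 560*x^3" if "x \<in> tetra_roots" for x
  proof -
    note r = root_power4[OF that]
    show 2: "g x ^ 2 = -9 - 21*x + 28*x^2 - 6*x^3" unfolding g_def using r by algebra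
    show "g x ^ 3 = -22 - 86*x - 201*x^2 + 136*x^3"
      unfolding power3_eq_cube using 2 r g_def[of x] by algebra
    show "g x ^ 4 = 853 + 850*x + 445*x^2 - 560*x^3" using 2 r by algebra
  qed
  have "(\<Sum>x\<in>tetra_roots. g x) = -5"
    using W[where w = g and ?a0.0 = "-1" and ?a1.0 = 6 and ?a2.0 = 0 and ?a3.0 = "-1"]
    by (simp add: g_def)
  moreover have "(\<Sum>x\<in>tetra_roots. g x ^ 2) = -15"
    using W[where w = "\<lambda>x. g x ^ 2" and ?a0.0 = "-9" and ?a1.0 = "-21" and ?a2.0 = 28 and ?a3.0 = "-6"]
    by (simp add: g2)
  moreover have "(\<Sum>x\<in>tetra_roots. g x ^ 3) = 175"
    using W[where w = "\<lambda>x. g x ^ 3" and ?a0.0 = "-22" and ?a1.0 = "-86" and ?a2.0 = "-201" and ?a3.0 = 136]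
    by (simp add: g3)
  moreover have "(\<Sum>x\<in>tetra_roots. g x ^ 4) = 1677"
    using W[where w = "\<lambda>x. g x ^ 4" and ?a0.0 = 853 and ?a1.0 = 850 and ?a2.0 = 445 and ?a3.0 = "-560"]
    by (simp add: g4)
  moreover have newton: "24 * (a*b*c*d) = (a+b+c+d)^4 - 6*(a+b+c+d)^2*(a^2+b^2+c^2+d^2)
      + 3*(a^2+b^2+c^2+d^2)^2 + 8*(a+b+c+d)*(a^3+b^3+c^3+d^3) - 6*(a^4+b^4+c^4+d^4)"
    for a b c d :: complex by algebra
  ultimately have "24 * (g (lam 1) * g (lam 2) * g (lam 3) * g (lam 4)) = -13512"
    unfolding newton sum_tetra_roots[OF lam] by simp
  then have "g (lam 1) * g (lam 2) * g (lam 3) * g (lam 4) = -563" by algebra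
  moreover have "tetra_coeff x = 1 / g x" for x
    by (simp add: tetra_coeff_def g_def)
  ultimately show ?thesis by (simp add: mult.assoc)
qed

section \<open>Exponential generating functions\<close>

unbundle fps_syntax

text \<open>Multi-index sums are peeled one index at a time: \<open>wt\<close> is the sum of the remaining indices, so
  a composition of \<open>n\<close> is a first index \<open>k\<close> together with a composition of \<open>n - k\<close>.\<close>

lemma sum_over_compositions_step:
  fixes F :: "nat \<Rightarrow> 'b \<Rightarrow> 'a::comm_monoid_add" and wt :: "'b \<Rightarrow> nat"
  assumes "\<And>m. finite {r. wt r = m}"
  shows "(\<Sum>(k, r) \<in> {(k, r). k + wt r = n}. F k r) = (\<Sum>k=0..n. \<Sum>r\<in>{r. wt r = n - k}. F k r)"
proof -
  have "{(k, r). k + wt r = n} = Sigma {0..n} (\<lambda>k. {r. wt r = n - k})" by auto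
  then show ?thesis using assms by (simp add: sum.Sigma)
qed

lemma finite_compositions_step:
  assumes "\<And>m. finite {r. wt r = m}"
  shows "finite {kr. (case kr of (k, r) \<Rightarrow> k + wt r) = (n::nat)}"
proof -
  have "{kr. (case kr of (k, r) \<Rightarrow> k + wt r) = n} = Sigma {0..n} (\<lambda>k. {r. wt r = n - k})" by auto
  then show ?thesis using assms by simp
qed

text \<open>A Cauchy product with one more factor adds one more index; iterating from two factors gives
  the sums over three, four and five indices.\<close>

lemma fps_mult_nth_step:
  fixes f G :: "'a::comm_ring_1 fps"
  assumes "\<And>m. finite {r. wt r = m}" and "\<And>m. G $ m = sum g {r. wt r = m}"
  shows "(f * G) $ n = (\<Sum>(k, r) \<in> {(k, r). k + wt r = n}. f $ k * g r)"
  by (simp add: sum_over_compositions_step[OF assms(1)] fps_mult_nth assms(2) sum_distrib_left)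

lemma finite_compositions:
  fixes n :: nat
  shows "finite {(k1, k2). k1 + k2 = n}"
    and "finite {(k1, k2, k3). k1 + k2 + k3 = n}"
    and "finite {(k1, k2, k3, k4). k1 + k2 + k3 + k4 = n}"
proof -
  have 2: "finite {(k1, k2). k1 + k2 = m}" for m :: nat
    using finite_compositions_step[of "\<lambda>k. k" m] by (simp add: case_prod_unfold)
  have 3: "finite {(k1, k2, k3). k1 + k2 + k3 = m}" for m :: nat
    using finite_compositions_step[of "\<lambda>(k1, k2). k1 + k2" m] 2
    by (simp add: case_prod_unfold add.assoc)
  have 4: "finite {(k1, k2, k3, k4). k1 + k2 + k3 + k4 = m}" for m :: nat
    using finite_compositions_step[of "\<lambda>(k1, k2, k3). k1 + k2 + k3" m] 3
    by (simp add: case_prod_unfold add.assoc)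
  show "finite {(k1, k2). k1 + k2 = n}"
    "finite {(k1, k2, k3). k1 + k2 + k3 = n}"
    "finite {(k1, k2, k3, k4). k1 + k2 + k3 + k4 = n}"
    by (rule 2 3 4)+
qed

lemma fps_mult_nth_compositions:
  fixes f1 f2 f3 f4 f5 :: "'a::comm_ring_1 fps"
  shows "(f1 * f2) $ n = (\<Sum>(k1, k2) \<in> {(k1, k2). k1 + k2 = n}. f1 $ k1 * f2 $ k2)"
    and "(f1 * (f2 * f3)) $ n
      = (\<Sum>(k1, k2, k3) \<in> {(k1, k2, k3). k1 + k2 + k3 = n}. f1 $ k1 * (f2 $ k2 * f3 $ k3))"
    and "(f1 * (f2 * (f3 * f4))) $ n
      = (\<Sum>(k1, k2, k3, k4) \<in> {(k1, k2, k3, k4). k1 + k2 + k3 + k4 = n}.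
          f1 $ k1 * (f2 $ k2 * (f3 $ k3 * f4 $ k4)))"
    and "(f1 * (f2 * (f3 * (f4 * f5)))) $ n
      = (\<Sum>(k1, k2, k3, k4, k5) \<in> {(k1, k2, k3, k4, k5). k1 + k2 + k3 + k4 + k5 = n}.
          f1 $ k1 * (f2 $ k2 * (f3 $ k3 * (f4 $ k4 * f5 $ k5))))"
proof -
  have 2: "(f * g) $ m = (\<Sum>(k1, k2) \<in> {(k1, k2). k1 + k2 = m}. f $ k1 * g $ k2)"
    for f g :: "'a fps" and m
    using fps_mult_nth_step[of "\<lambda>k. k" g "\<lambda>k. g $ k" f m] by simp
  have 3: "(f * (g * h)) $ m
      = (\<Sum>(k1, k2, k3) \<in> {(k1, k2, k3). k1 + k2 + k3 = m}. f $ k1 * (g $ k2 * h $ k3))"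
    for f g h :: "'a fps" and m
    using fps_mult_nth_step[of "\<lambda>(k1, k2). k1 + k2" "g * h" "\<lambda>(k1, k2). g $ k1 * h $ k2" f m]
      finite_compositions(1) 2[of g h]
    by (simp add: case_prod_unfold add.assoc)
  have 4: "(f * (g * (h * e))) $ m
      = (\<Sum>(k1, k2, k3, k4) \<in> {(k1, k2, k3, k4). k1 + k2 + k3 + k4 = m}.
          f $ k1 * (g $ k2 * (h $ k3 * e $ k4)))"
    for f g h e :: "'a fps" and m
    using fps_mult_nth_step[of "\<lambda>(k1, k2, k3). k1 + k2 + k3" "g * (h * e)"
        "\<lambda>(k1, k2, k3). g $ k1 * (h $ k2 * e $ k3)" f m]
      finite_compositions(2) 3[of g h e]
    by (simp add: case_prod_unfold add.assoc)
  show "(f1 * f2) $ n = (\<Sum>(k1, k2) \<in> {(k1, k2). k1 + k2 = n}. f1 $ k1 * f2 $ k2)"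
    by (rule 2)
  show "(f1 * (f2 * f3)) $ n
      = (\<Sum>(k1, k2, k3) \<in> {(k1, k2, k3). k1 + k2 + k3 = n}. f1 $ k1 * (f2 $ k2 * f3 $ k3))"
    by (rule 3)
  show "(f1 * (f2 * (f3 * f4))) $ n
      = (\<Sum>(k1, k2, k3, k4) \<in> {(k1, k2, k3, k4). k1 + k2 + k3 + k4 = n}.
          f1 $ k1 * (f2 $ k2 * (f3 $ k3 * f4 $ k4)))"
    by (rule 4)
  show "(f1 * (f2 * (f3 * (f4 * f5)))) $ n
      = (\<Sum>(k1, k2, k3, k4, k5) \<in> {(k1, k2, k3, k4, k5). k1 + k2 + k3 + k4 + k5 = n}.
          f1 $ k1 * (f2 $ k2 * (f3 $ k3 * (f4 $ k4 * f5 $ k5))))"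
    using fps_mult_nth_step[of "\<lambda>(k1, k2, k3, k4). k1 + k2 + k3 + k4" "f2 * (f3 * (f4 * f5))"
        "\<lambda>(k1, k2, k3, k4). f2 $ k1 * (f3 $ k2 * (f4 $ k3 * f5 $ k4))" f1 n]
      finite_compositions(3) 4[of f2 f3 f4 f5]
    by (simp add: case_prod_unfold add.assoc)
qed

definition egf_nth :: "complex fps \<Rightarrow> nat \<Rightarrow> complex" where
  "egf_nth f n = fact n * f $ n"

lemma egf_nth_egf [simp]: "egf_nth (egf a) n = a n"
  by (simp add: egf_nth_def egf_def)

lemma egf_egf_nth [simp]: "egf (egf_nth f) = f"
  by (simp add: fps_eq_iff egf_nth_def egf_def)

lemma egf_nth_linear:
  "egf_nth (f + g) n = egf_nth f n + egf_nth g n"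
  "egf_nth (f - g) n = egf_nth f n - egf_nth g n"
  "egf_nth (fps_const c * f) n = c * egf_nth f n"
  by (simp_all add: egf_nth_def algebra_simps)

lemma egf_nth_binomial:
  "egf_nth (egf a * egf b) n = (\<Sum>k=0..n. of_nat (n choose k) * a k * b (n - k))"
  unfolding egf_nth_def fps_mult_nth sum_distrib_left
  by (intro sum.cong refl) (simp add: egf_def binomial_fact field_simps)

lemma egf_nth_multinomial:
  "egf_nth (egf a * (egf b * egf c)) n
    = (\<Sum>(k1, k2, k3) \<in> {(k1, k2, k3). k1 + k2 + k3 = n}.
        multinom n [k1, k2, k3] * (a k1 * b k2 * c k3))"
  "egf_nth (egf a * (egf b * (egf c * egf d))) n
    = (\<Sum>(k1, k2, k3, k4) \<in> {(k1, k2, k3, k4). k1 + k2 + k3 + k4 = n}.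
        multinom n [k1, k2, k3, k4] * (a k1 * b k2 * c k3 * d k4))"
  "egf_nth (egf a * (egf b * (egf c * (egf d * egf e)))) n
    = (\<Sum>(k1, k2, k3, k4, k5) \<in> {(k1, k2, k3, k4, k5). k1 + k2 + k3 + k4 + k5 = n}.
        multinom n [k1, k2, k3, k4, k5] * (a k1 * b k2 * c k3 * d k4 * e k5))"
proof -
  show "egf_nth (egf a * (egf b * egf c)) n
    = (\<Sum>(k1, k2, k3) \<in> {(k1, k2, k3). k1 + k2 + k3 = n}.
        multinom n [k1, k2, k3] * (a k1 * b k2 * c k3))"
    unfolding egf_nth_def fps_mult_nth_compositions(2) sum_distrib_left
    by (intro sum.cong refl) (auto simp: egf_def multinom_def)
  show "egf_nth (egf a * (egf b * (egf c * egf d))) n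
    = (\<Sum>(k1, k2, k3, k4) \<in> {(k1, k2, k3, k4). k1 + k2 + k3 + k4 = n}.
        multinom n [k1, k2, k3, k4] * (a k1 * b k2 * c k3 * d k4))"
    unfolding egf_nth_def fps_mult_nth_compositions(3) sum_distrib_left
    by (intro sum.cong refl) (auto simp: egf_def multinom_def)
  show "egf_nth (egf a * (egf b * (egf c * (egf d * egf e)))) n
    = (\<Sum>(k1, k2, k3, k4, k5) \<in> {(k1, k2, k3, k4, k5). k1 + k2 + k3 + k4 + k5 = n}.
        multinom n [k1, k2, k3, k4, k5] * (a k1 * b k2 * c k3 * d k4 * e k5))"
    unfolding egf_nth_def fps_mult_nth_compositions(4) sum_distrib_left
    by (intro sum.cong refl) (auto simp: egf_def multinom_def)
qed

text \<open>The series of an index that no sequence in a multinomial sum depends on.\<close>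

lemma egf_one: "egf (\<lambda>_. 1) = fps_exp 1"
  by (simp add: fps_eq_iff egf_def)

text \<open>Scaling the \<open>n\<close>-th term by \<open>r\<^sup>n\<close> scales the exponents; with \<open>r = k\<close> this matches the
  exponentials in the \<open>k\<close>-th powers of the modes, and with \<open>r = -1\<close> those in their reciprocals.\<close>

lemma egf_weighted_powers:
  assumes "\<And>n. (\<Sum>x\<in>B. w x * x ^ n) = s n"
  shows "egf (\<lambda>n. r ^ n * s n) = (\<Sum>x\<in>B. fps_const (w x) * fps_exp (r * x))"
  by (simp add: fps_eq_iff egf_def fps_sum_nth assms[symmetric] sum_distrib_left sum_divide_distrib
      power_mult_distrib mult.left_commute)

text \<open>The summand \<open>c exp (\<lambda> x)\<close> that a root \<open>\<lambda>\<close> contributes to the generating function of \<open>T\<close>.\<close>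

definition mode :: "complex \<Rightarrow> complex fps" where
  "mode x = fps_const (tetra_coeff x) * fps_exp x"

lemma mode_power: "mode x ^ k = fps_const (tetra_coeff x ^ k) * fps_exp (of_nat k * x)"
  by (simp add: mode_def power_mult_distrib fps_exp_power_mult)

lemma fps_const_sum_left:
  fixes q :: complex
  shows "(\<Sum>x\<in>B. fps_const (q * w x) * f x)
    = fps_const q * (\<Sum>x\<in>B. fps_const (w x) * f x)"
  by (simp only: sum_distrib_left fps_const_mult[symmetric] mult.assoc)

lemma egf_power_sums:
  assumes lam: "bij_betw lam {1..4::nat} tetra_roots"
  shows "egf tetT = (\<Sum>x\<in>tetra_roots. mode x)"
    and "egf (\<lambda>n. 2^n * tetU n) = fps_const 563 * (\<Sum>x\<in>tetra_roots. mode x ^ 2)"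
    and "egf (\<lambda>n. 3^n * tetV n) = fps_const 563 * (\<Sum>x\<in>tetra_roots. mode x ^ 3)"
    and "egf (\<lambda>n. 4^n * tetW n) = fps_const (563^2) * (\<Sum>x\<in>tetra_roots. mode x ^ 4)"
    and "egf (\<lambda>n. 5^n * tetX n) = fps_const (563^2) * (\<Sum>x\<in>tetra_roots. mode x ^ 5)"
  using egf_weighted_powers[OF coeff_power_sums(1)[OF lam], of 1]
    egf_weighted_powers[OF coeff_power_sums(2)[OF lam], of 2]
    egf_weighted_powers[OF coeff_power_sums(3)[OF lam], of 3]
    egf_weighted_powers[OF coeff_power_sums(4)[OF lam], of 4]
    egf_weighted_powers[OF coeff_power_sums(5)[OF lam], of 5]
  by (simp_all only: fps_const_sum_left mode_power of_nat_numeral)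
    (simp only: mode_def power_one mult_1_left)

lemma mode_product:
  assumes lam: "bij_betw lam {1..4::nat} tetra_roots"
  shows "mode (lam 1) * mode (lam 2) * mode (lam 3) * mode (lam 4) = fps_const (-1/563) * fps_exp 1"
proof -
  have "mode (lam 1) * mode (lam 2) * mode (lam 3) * mode (lam 4)
      = fps_const (tetra_coeff (lam 1) * tetra_coeff (lam 2) * tetra_coeff (lam 3) * tetra_coeff (lam 4))
        * fps_exp (lam 1 + lam 2 + lam 3 + lam 4)"
    by (simp only: mode_def fps_exp_add_mult fps_const_mult[symmetric] ac_simps)
  then show ?thesis by (simp only: coeff_product[OF lam] roots_vieta(1)[OF lam])
qed

text \<open>The elementary symmetric function \<open>e\<^sub>3\<close> is \<open>e\<^sub>4\<close> times the sum of the reciprocals of the modes.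
  The reciprocal weights generate \<open>Y\<close>, and \<open>e\<^sub>4\<close> is a multiple of \<open>exp x\<close>.\<close>

lemma egf_triple_products:
  assumes lam: "bij_betw lam {1..4::nat} tetra_roots"
  defines "a \<equiv> mode (lam 1)" and "b \<equiv> mode (lam 2)" and "c \<equiv> mode (lam 3)" and "d \<equiv> mode (lam 4)"
  shows "egf (\<lambda>n. (-1)^n * tetY n) * fps_exp 1 = fps_const (-563) * (a*b*c + a*b*d + a*c*d + b*c*d)"
proof -
  define inv where "inv x = fps_const (- (x^3) + 6*x - 1) * fps_exp (- x)" for x :: complex
  have root: "lam i \<in> tetra_roots" if "i \<in> {1..4}" for i
    using lam that by (auto simp: bij_betw_def)
  have inv: "mode x * inv x = 1" if "x \<in> tetra_roots" for x
  proof -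
    have "mode x * inv x = fps_const (tetra_coeff x * (- (x^3) + 6*x - 1)) * fps_exp (x + - x)"
      unfolding mode_def inv_def fps_exp_add_mult fps_const_mult[symmetric] by (simp only: ac_simps)
    then show ?thesis unfolding coeff_inverse(1)[OF that] by simp
  qed
  have *: "a * inv (lam 1) = 1" "b * inv (lam 2) = 1" "c * inv (lam 3) = 1" "d * inv (lam 4) = 1"
    unfolding a_def b_def c_def d_def by (rule inv[OF root], simp)+
  have "egf (\<lambda>n. (-1)^n * tetY n) = inv (lam 1) + inv (lam 2) + inv (lam 3) + inv (lam 4)"
    using egf_weighted_powers[OF coeff_power_sums(6)[OF lam], of "-1"]
    by (simp add: sum_tetra_roots[OF lam] inv_def)
  moreover have "fps_exp 1 = fps_const (-563) * (a * b * c * d)"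
  proof -
    have "fps_const (-563) * (fps_const (-1/563) * fps_exp 1) = (fps_exp 1 :: complex fps)"
      by (simp only: mult.assoc[symmetric] fps_const_mult) simp
    then show ?thesis
      by (simp only: a_def b_def c_def d_def mode_product[OF lam])
  qed
  ultimately have "egf (\<lambda>n. (-1)^n * tetY n) * fps_exp 1
      = fps_const (-563) * ((inv (lam 1) + inv (lam 2) + inv (lam 3) + inv (lam 4)) * (a * b * c * d))"
    by (simp only: mult.left_commute)
  also have "(inv (lam 1) + inv (lam 2) + inv (lam 3) + inv (lam 4)) * (a * b * c * d)
      = a*b*c + a*b*d + a*c*d + b*c*d"
    using * by algebra
  finally show ?thesis .
qed

text \<open>Newton's formula \<open>2 e\<^sub>2 = p\<^sub>1\<^sup>2 - p\<^sub>2\<close>: this is the reason for subtracting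
  \<open>2\<^sup>n U\<^sub>n / 563\<close> and halving in the definition of \<open>t\<close>.\<close>

lemma egf_small_t:
  assumes lam: "bij_betw lam {1..4::nat} tetra_roots"
  defines "a \<equiv> mode (lam 1)" and "b \<equiv> mode (lam 2)" and "c \<equiv> mode (lam 3)" and "d \<equiv> mode (lam 4)"
  shows "egf small_t = a*b + a*c + a*d + b*c + b*d + c*d"
proof -
  have T: "egf tetT = a + b + c + d"
    by (simp add: egf_power_sums(1)[OF lam] sum_tetra_roots[OF lam] a_def b_def c_def d_def)
  have U: "egf (\<lambda>n. 2^n * tetU n) = fps_const 563 * (a^2 + b^2 + c^2 + d^2)"
    by (simp add: egf_power_sums(2)[OF lam] sum_tetra_roots[OF lam] a_def b_def c_def d_def)
  have sq: "(a + b + c + d) * (a + b + c + d)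
      = (a^2 + b^2 + c^2 + d^2) + fps_const 2 * (a*b + a*c + a*d + b*c + b*d + c*d)"
    by (simp only: numeral_fps_const[symmetric]) algebra
  have "small_t n = egf_nth (a*b + a*c + a*d + b*c + b*d + c*d) n" for n
  proof -
    have "(\<Sum>k=0..n. of_nat (n choose k) * tetT k * tetT (n - k))
        = egf_nth (a^2 + b^2 + c^2 + d^2) n + 2 * egf_nth (a*b + a*c + a*d + b*c + b*d + c*d) n"
      unfolding egf_nth_binomial[symmetric] T sq by (simp only: egf_nth_linear)
    moreover have "2^n * tetU n = 563 * egf_nth (a^2 + b^2 + c^2 + d^2) n"
      using arg_cong[OF U, of "\<lambda>f. egf_nth f n"] by (simp only: egf_nth_linear egf_nth_egf)
    ultimately show ?thesis by (simp add: small_t_def)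
  qed
  then show ?thesis by (metis egf_egf_nth ext)
qed

lemma triple_series_modes:
  fixes lam :: "nat \<Rightarrow> complex"
  defines "a \<equiv> mode (lam 1)" and "b \<equiv> mode (lam 2)" and "c \<equiv> mode (lam 3)" and "d \<equiv> mode (lam 4)"
  shows "triple_series lam p = a*b*c*(a + b + c)^p + a*b*d*(a + b + d)^p
    + a*c*d*(a + c + d)^p + b*c*d*(b + c + d)^p"
proof -
  have "i \<in> {1, 2, 3, 4}" if "1 \<le> i" "i \<le> 4" for i :: nat using that by auto
  then have "{(i, j, l). 1 \<le> i \<and> i < j \<and> j < l \<and> l \<le> (4::nat)}
      = {(1, 2, 3), (1, 2, 4), (1, 3, 4), (2, 3, 4)}"
    by fastforce
  moreover have "fps_const (tetra_coeff x * tetra_coeff y * tetra_coeff z) * fps_exp (x + y + z)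
      = mode x * mode y * mode z" for x y z
    by (simp only: mode_def fps_exp_add_mult fps_const_mult[symmetric] ac_simps)
  ultimately show ?thesis
    by (simp add: triple_series_def Let_def a_def b_def c_def d_def add.assoc flip: mode_def)
qed

section \<open>Symmetric functions of degree five\<close>

text \<open>Each side becomes a polynomial in \<open>e\<^sub>1, \<dots>, e\<^sub>4\<close>, where the identities are immediate: the power sums by
  Newton's formulas, and \<open>t k\<close> because its summand that omits a variable \<open>y\<close> is
  \<open>(e\<^sub>4 / y) (e\<^sub>1 - y)\<^sup>k\<close>, so that for \<open>k = 2\<close> the sum is
  \<open>e\<^sub>3 e\<^sub>1\<^sup>2 - 8 e\<^sub>4 e\<^sub>1 + e\<^sub>4 e\<^sub>1\<close>.\<close>

lemma quintic_symmetric_identities: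
  fixes a b c d :: "'a::comm_ring_1"
  assumes "\<And>k. p k = a^k + b^k + c^k + d^k"
    and "e1 = a + b + c + d"
    and "e2 = a*b + a*c + a*d + b*c + b*d + c*d"
    and "e3 = a*b*c + a*b*d + a*c*d + b*c*d"
    and "e4 = a*b*c*d"
    and "\<And>k. t k = a*b*c*(a + b + c)^k + a*b*d*(a + b + d)^k + a*c*d*(a + c + d)^k + b*c*d*(b + c + d)^k"
  shows "e1 * (e1 * (e1 * (e1 * e1)))
      = 20 * t 2 - 14 * p 5 + 5 * (p 4 * e1) + 90 * (e4 * e1) + 10 * (p 3 * p 2) - 10 * (e3 * e2)"
    and "t 1 * e1 = t 2 + 3 * (e4 * e1)"
    and "p 3 * e2 = t 2 - p 5 + p 4 * e1 + 6 * (e4 * e1) - 2 * (e3 * e2)"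
    and "e3 * p 2 = t 2 + 7 * (e4 * e1) - 2 * (e3 * e2)"
    and "p 3 * (e1 * e1) = 2 * t 2 - 2 * p 5 + 2 * (p 4 * e1) + 12 * (e4 * e1) + p 3 * p 2 - 4 * (e3 * e2)"
    and "e3 * (e1 * e1) = t 2 + 7 * (e4 * e1)"
    and "p 2 * (p 2 * e1) = p 4 * e1 - 2 * p 5 - 6 * (e4 * e1) + 2 * (p 3 * p 2) + 2 * (e3 * e2)"
    and "e2 * (e2 * e1) = 2 * t 2 - p 5 + 9 * (e4 * e1) + p 3 * p 2 + e3 * e2"
    and "p 2 * (e2 * e1) = 3 * t 2 - 2 * p 5 + p 4 * e1 + 15 * (e4 * e1) + p 3 * p 2 - 4 * (e3 * e2)"
    and "p 2 * (e1 * (e1 * e1))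
      = 6 * t 2 - 6 * p 5 + 3 * (p 4 * e1) + 24 * (e4 * e1) + 4 * (p 3 * p 2) - 6 * (e3 * e2)"
    and "e2 * (e1 * (e1 * e1))
      = 7 * t 2 - 4 * p 5 + p 4 * e1 + 33 * (e4 * e1) + 3 * (p 3 * p 2) - 2 * (e3 * e2)"
proof -
  have p1: "p 1 = e1" unfolding assms by simp
  have p2: "p 2 = e1 * e1 - 2 * e2"
    unfolding assms by (simp add: power2_eq_square algebra_simps)
  have p3: "p 3 = e1 * p 2 - e2 * p 1 + 3 * e3"
    unfolding assms by (simp add: eval_nat_numeral algebra_simps)
  have p4: "p 4 = e1 * p 3 - e2 * p 2 + e3 * p 1 - 4 * e4"
    unfolding assms by (simp add: eval_nat_numeral algebra_simps)
  have p5: "p 5 = e1 * p 4 - e2 * p 3 + e3 * p 2 - e4 * p 1"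
    unfolding assms by (simp add: eval_nat_numeral algebra_simps)
  have t1: "t 1 = e3 * e1 - 4 * e4"
    unfolding assms by (simp add: algebra_simps)
  have t2: "t 2 = e3 * (e1 * e1) - 7 * (e4 * e1)"
    unfolding assms by (simp add: power2_eq_square algebra_simps)
  note elementary = p5 p4 p3 p2 p1 t1 t2
  show "e1 * (e1 * (e1 * (e1 * e1)))
      = 20 * t 2 - 14 * p 5 + 5 * (p 4 * e1) + 90 * (e4 * e1) + 10 * (p 3 * p 2) - 10 * (e3 * e2)"
    unfolding elementary by (simp add: algebra_simps)
  show "t 1 * e1 = t 2 + 3 * (e4 * e1)"
    unfolding elementary by (simp add: algebra_simps)
  show "p 3 * e2 = t 2 - p 5 + p 4 * e1 + 6 * (e4 * e1) - 2 * (e3 * e2)"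
    unfolding elementary by (simp add: algebra_simps)
  show "e3 * p 2 = t 2 + 7 * (e4 * e1) - 2 * (e3 * e2)"
    unfolding elementary by (simp add: algebra_simps)
  show "p 3 * (e1 * e1) = 2 * t 2 - 2 * p 5 + 2 * (p 4 * e1) + 12 * (e4 * e1) + p 3 * p 2 - 4 * (e3 * e2)"
    unfolding elementary by (simp add: algebra_simps)
  show "e3 * (e1 * e1) = t 2 + 7 * (e4 * e1)"
    unfolding elementary by (simp add: algebra_simps)
  show "p 2 * (p 2 * e1) = p 4 * e1 - 2 * p 5 - 6 * (e4 * e1) + 2 * (p 3 * p 2) + 2 * (e3 * e2)"
    unfolding elementary by (simp add: algebra_simps)
  show "e2 * (e2 * e1) = 2 * t 2 - p 5 + 9 * (e4 * e1) + p 3 * p 2 + e3 * e2"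
    unfolding elementary by (simp add: algebra_simps)
  show "p 2 * (e2 * e1) = 3 * t 2 - 2 * p 5 + p 4 * e1 + 15 * (e4 * e1) + p 3 * p 2 - 4 * (e3 * e2)"
    unfolding elementary by (simp add: algebra_simps)
  show "p 2 * (e1 * (e1 * e1))
      = 6 * t 2 - 6 * p 5 + 3 * (p 4 * e1) + 24 * (e4 * e1) + 4 * (p 3 * p 2) - 6 * (e3 * e2)"
    unfolding elementary by (simp add: algebra_simps)
  show "e2 * (e1 * (e1 * e1))
      = 7 * t 2 - 4 * p 5 + p 4 * e1 + 33 * (e4 * e1) + 3 * (p 3 * p 2) - 2 * (e3 * e2)"
    unfolding elementary by (simp add: algebra_simps)
qed

section \<open>The identity\<close>

theorem theorem9:
  fixes lam :: "nat \<Rightarrow> complex"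
    and A D E F G H I J K L M N P Q R S :: complex
    and n :: nat
  assumes lam: "bij_betw lam {1..4} tetra_roots"
    and A: "A = I + 2*L + 2*N + P + 2*Q + 6*R + 4*S - 14"
    and D: "D = - G - I - J - 2*L - M - 2*P - 3*Q - 6*R - 7*S + 20"
    and E: "E = - I - 2*L - N - Q - 3*R - S + 5"
    and F: "F = - 3*G - 6*I - 7*J - 7*M + 6*N - 12*L - 9*P - 15*Q - 24*R - 33*S + 90"
    and H: "H = - L - 2*N - P - Q - 4*R - 3*S + 10"
    and K: "K = 2*I + 2*J - 2*N + 4*L - P + 4*Q + 6*R + 2*S - 10"
    and D_nz: "D \<noteq> 0"
  shows "D * t_four lam n =
      (\<Sum>(k1, k2, k3, k4, k5) \<in> {(k1, k2, k3, k4, k5). k1 + k2 + k3 + k4 + k5 = n}.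
         multinom n [k1, k2, k3, k4, k5] * tetT k1 * tetT k2 * tetT k3 * tetT k4 * tetT k5)
    - A / 563^2 * 5^n * tetX n
    - E / 563^2 * (\<Sum>k=0..n. of_nat (n choose k) * 4^(n - k) * tetW (n - k) * tetT k)
    + F / 563 * (\<Sum>k=0..n. of_nat (n choose k) * tetT k)
    - G * (\<Sum>k=0..n. of_nat (n choose k) * t_one lam k * tetT (n - k))
    - H / 563^2 * (\<Sum>k=0..n. of_nat (n choose k) * 3^(n - k) * 2^k * tetV (n - k) * tetU k)
    - I / 563 * (\<Sum>k=0..n. of_nat (n choose k) * 3^k * tetV k * small_t (n - k))
    + J / 563^2 * (\<Sum>(k1, k2, k3) \<in> {(k1, k2, k3). k1 + k2 + k3 = n}.
         multinom n [k1, k2, k3] * (-1)^k1 * 2^k2 * tetY k1 * tetU k2)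
    + K / 563 * (\<Sum>(k1, k2, k3) \<in> {(k1, k2, k3). k1 + k2 + k3 = n}.
         multinom n [k1, k2, k3] * (-1)^k1 * tetY k1 * small_t k2)
    - L / 563 * (\<Sum>(k1, k2, k3) \<in> {(k1, k2, k3). k1 + k2 + k3 = n}.
         multinom n [k1, k2, k3] * 3^k1 * tetV k1 * tetT k2 * tetT k3)
    + M / 563 * (\<Sum>(k1, k2, k3, k4) \<in> {(k1, k2, k3, k4). k1 + k2 + k3 + k4 = n}.
         multinom n [k1, k2, k3, k4] * (-1)^k1 * tetY k1 * tetT k2 * tetT k3)
    - N / 563^2 * (\<Sum>(k1, k2, k3) \<in> {(k1, k2, k3). k1 + k2 + k3 = n}.
         multinom n [k1, k2, k3] * 2^k1 * tetU k1 * 2^k2 * tetU k2 * tetT k3)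
    - P * (\<Sum>(k1, k2, k3) \<in> {(k1, k2, k3). k1 + k2 + k3 = n}.
         multinom n [k1, k2, k3] * small_t k1 * small_t k2 * tetT k3)
    - Q / 563 * (\<Sum>(k1, k2, k3) \<in> {(k1, k2, k3). k1 + k2 + k3 = n}.
         multinom n [k1, k2, k3] * 2^k1 * tetU k1 * small_t k2 * tetT k3)
    - R / 563 * (\<Sum>(k1, k2, k3, k4) \<in> {(k1, k2, k3, k4). k1 + k2 + k3 + k4 = n}.
         multinom n [k1, k2, k3, k4] * 2^k1 * tetU k1 * tetT k2 * tetT k3 * tetT k4)
    - S * (\<Sum>(k1, k2, k3, k4) \<in> {(k1, k2, k3, k4). k1 + k2 + k3 + k4 = n}.
         multinom n [k1, k2, k3, k4] * small_t k1 * tetT k2 * tetT k3 * tetT k4)"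
proof -
  define a b c d where abcd: "a = mode (lam 1)" "b = mode (lam 2)" "c = mode (lam 3)" "d = mode (lam 4)"
  define p where "p k = a^k + b^k + c^k + d^k" for k :: nat
  define e1 where "e1 = a + b + c + d"
  define e2 where "e2 = a*b + a*c + a*d + b*c + b*d + c*d"
  define e3 where "e3 = a*b*c + a*b*d + a*c*d + b*c*d"
  define e4 where "e4 = a*b*c*d"
  define t where "t k = a*b*c*(a + b + c)^k + a*b*d*(a + b + d)^k + a*c*d*(a + c + d)^k + b*c*d*(b + c + d)^k"
    for k :: nat
  define Phi where "Phi f = egf_nth f n" for f
  have Phi_linear:
    "Phi (f + g) = Phi f + Phi g" "Phi (f - g) = Phi f - Phi g"
    "Phi (numeral m * f) = numeral m * Phi f" "Phi (fps_const q * f) = q * Phi f" for f g m q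
    unfolding Phi_def numeral_fps_const by (simp_all only: egf_nth_linear)
  note pull = mult.left_commute[of "p _" "fps_const _"] mult.left_commute[of e1 "fps_const _"]
    mult.left_commute[of e3 "fps_const _"]
  have T: "egf tetT = e1" and U: "egf (\<lambda>n. 2^n * tetU n) = fps_const 563 * p 2"
    and V: "egf (\<lambda>n. 3^n * tetV n) = fps_const 563 * p 3"
    and W: "egf (\<lambda>n. 4^n * tetW n) = fps_const (563^2) * p 4"
    and X: "egf (\<lambda>n. 5^n * tetX n) = fps_const (563^2) * p 5"
    by (simp_all only: egf_power_sums[OF lam] sum_tetra_roots[OF lam] abcd p_def e1_def)
  have st: "egf small_t = e2"
    unfolding e2_def abcd by (rule egf_small_t[OF lam])
  have Y: "egf (\<lambda>n. (-1)^n * tetY n) * fps_exp 1 = fps_const (-563) * e3"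
    unfolding e3_def abcd by (rule egf_triple_products[OF lam])
  have one: "fps_exp 1 = fps_const (-563) * e4"
  proof -
    have "e4 = fps_const (-1/563) * fps_exp 1"
      unfolding e4_def abcd by (rule mode_product[OF lam])
    then show ?thesis by (simp add: mult.assoc[symmetric])
  qed
  have t1: "egf (t_one lam) = t 1" and t4: "egf (t_four lam) = t 2"
    unfolding egf_t_one egf_t_four t_def abcd by (rule triple_series_modes)+

  \<comment> \<open>each sum of the statement is the coefficient of a product of symmetric functions\<close>
  have s_TTTTT: "(\<Sum>(k1, k2, k3, k4, k5) \<in> {(k1, k2, k3, k4, k5). k1 + k2 + k3 + k4 + k5 = n}.
         multinom n [k1, k2, k3, k4, k5] * tetT k1 * tetT k2 * tetT k3 * tetT k4 * tetT k5)
      = Phi (e1 * (e1 * (e1 * (e1 * e1))))"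
    unfolding Phi_def T[symmetric] egf_nth_multinomial by (simp only: mult.assoc)
  have s_X: "5^n * tetX n = 563^2 * Phi (p 5)"
    unfolding Phi_linear(4)[symmetric] X[symmetric] unfolding Phi_def egf_nth_egf ..
  have s_WT: "(\<Sum>k=0..n. of_nat (n choose k) * 4^(n - k) * tetW (n - k) * tetT k) = 563^2 * Phi (p 4 * e1)"
  proof -
    have "egf_nth (egf tetT * egf (\<lambda>n. 4^n * tetW n)) n = 563^2 * Phi (p 4 * e1)"
      unfolding Phi_def[symmetric] W T mult.assoc pull Phi_linear by (simp add: mult_ac power2_eq_square)
    then show ?thesis unfolding egf_nth_binomial by (simp only: ac_simps)
  qed
  have s_T1: "(\<Sum>k=0..n. of_nat (n choose k) * tetT k) = - 563 * Phi (e4 * e1)"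
  proof -
    have "egf_nth (egf tetT * egf (\<lambda>_. 1)) n = - 563 * Phi (e4 * e1)"
      unfolding Phi_def[symmetric] T egf_one one mult.assoc pull Phi_linear by (simp add: mult_ac power2_eq_square)
    then show ?thesis unfolding egf_nth_binomial by simp
  qed
  have s_t1T: "(\<Sum>k=0..n. of_nat (n choose k) * t_one lam k * tetT (n - k)) = Phi (t 1 * e1)"
    unfolding Phi_def t1[symmetric] T[symmetric] egf_nth_binomial ..
  have s_VU: "(\<Sum>k=0..n. of_nat (n choose k) * 3^(n - k) * 2^k * tetV (n - k) * tetU k)
      = 563^2 * Phi (p 3 * p 2)"
  proof -
    have "egf_nth (egf (\<lambda>n. 2^n * tetU n) * egf (\<lambda>n. 3^n * tetV n)) n = 563^2 * Phi (p 3 * p 2)"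
      unfolding Phi_def[symmetric] U V mult.assoc pull Phi_linear by (simp add: mult_ac power2_eq_square)
    then show ?thesis unfolding egf_nth_binomial by (simp only: ac_simps)
  qed
  have s_Vt: "(\<Sum>k=0..n. of_nat (n choose k) * 3^k * tetV k * small_t (n - k)) = 563 * Phi (p 3 * e2)"
  proof -
    have "egf_nth (egf (\<lambda>n. 3^n * tetV n) * egf small_t) n = 563 * Phi (p 3 * e2)"
      unfolding Phi_def[symmetric] V st mult.assoc pull Phi_linear by (simp add: mult_ac power2_eq_square)
    then show ?thesis unfolding egf_nth_binomial by (simp only: ac_simps)
  qed
  have s_YU: "(\<Sum>(k1, k2, k3) \<in> {(k1, k2, k3). k1 + k2 + k3 = n}.
         multinom n [k1, k2, k3] * (-1)^k1 * 2^k2 * tetY k1 * tetU k2) = - (563^2) * Phi (e3 * p 2)"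
  proof -
    have "egf_nth (egf (\<lambda>n. (-1)^n * tetY n) * (egf (\<lambda>n. 2^n * tetU n) * egf (\<lambda>_. 1))) n
        = Phi ((egf (\<lambda>n. (-1)^n * tetY n) * fps_exp 1) * (fps_const 563 * p 2))"
      unfolding Phi_def U egf_one by (simp only: ac_simps)
    also have "\<dots> = - (563^2) * Phi (e3 * p 2)"
      unfolding Y mult.assoc pull Phi_linear by simp
    finally show ?thesis unfolding egf_nth_multinomial by (simp add: ac_simps)
  qed
  have s_Yt: "(\<Sum>(k1, k2, k3) \<in> {(k1, k2, k3). k1 + k2 + k3 = n}.
         multinom n [k1, k2, k3] * (-1)^k1 * tetY k1 * small_t k2) = - 563 * Phi (e3 * e2)"
  proof -
    have "egf_nth (egf (\<lambda>n. (-1)^n * tetY n) * (egf small_t * egf (\<lambda>_. 1))) n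
        = Phi ((egf (\<lambda>n. (-1)^n * tetY n) * fps_exp 1) * e2)"
      unfolding Phi_def st egf_one by (simp only: ac_simps)
    also have "\<dots> = - 563 * Phi (e3 * e2)"
      unfolding Y mult.assoc Phi_linear ..
    finally show ?thesis unfolding egf_nth_multinomial by (simp add: ac_simps)
  qed
  have s_VTT: "(\<Sum>(k1, k2, k3) \<in> {(k1, k2, k3). k1 + k2 + k3 = n}.
         multinom n [k1, k2, k3] * 3^k1 * tetV k1 * tetT k2 * tetT k3) = 563 * Phi (p 3 * (e1 * e1))"
    unfolding Phi_linear(4)[symmetric] mult.assoc[of "fps_const _", symmetric]
    unfolding V[symmetric] T[symmetric] Phi_def egf_nth_multinomial by (simp only: mult.assoc)
  have s_YTT: "(\<Sum>(k1, k2, k3, k4) \<in> {(k1, k2, k3, k4). k1 + k2 + k3 + k4 = n}.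
         multinom n [k1, k2, k3, k4] * (-1)^k1 * tetY k1 * tetT k2 * tetT k3) = - 563 * Phi (e3 * (e1 * e1))"
  proof -
    have "egf_nth (egf (\<lambda>n. (-1)^n * tetY n) * (egf tetT * (egf tetT * egf (\<lambda>_. 1)))) n
        = Phi ((egf (\<lambda>n. (-1)^n * tetY n) * fps_exp 1) * (e1 * e1))"
      unfolding Phi_def T egf_one by (simp only: ac_simps)
    also have "\<dots> = - 563 * Phi (e3 * (e1 * e1))"
      unfolding Y mult.assoc Phi_linear ..
    finally show ?thesis unfolding egf_nth_multinomial by (simp add: ac_simps)
  qed
  have s_UUT: "(\<Sum>(k1, k2, k3) \<in> {(k1, k2, k3). k1 + k2 + k3 = n}.
         multinom n [k1, k2, k3] * 2^k1 * tetU k1 * 2^k2 * tetU k2 * tetT k3) = 563^2 * Phi (p 2 * (p 2 * e1))"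
  proof -
    have "egf_nth (egf (\<lambda>n. 2^n * tetU n) * (egf (\<lambda>n. 2^n * tetU n) * egf tetT)) n = 563^2 * Phi (p 2 * (p 2 * e1))"
      unfolding Phi_def[symmetric] U T mult.assoc pull Phi_linear by (simp add: mult_ac power2_eq_square)
    then show ?thesis unfolding egf_nth_multinomial by (simp only: mult.assoc)
  qed
  have s_ttT: "(\<Sum>(k1, k2, k3) \<in> {(k1, k2, k3). k1 + k2 + k3 = n}.
         multinom n [k1, k2, k3] * small_t k1 * small_t k2 * tetT k3) = Phi (e2 * (e2 * e1))"
    unfolding Phi_def st[symmetric] T[symmetric] egf_nth_multinomial by (simp only: mult.assoc)
  have s_UtT: "(\<Sum>(k1, k2, k3) \<in> {(k1, k2, k3). k1 + k2 + k3 = n}.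
         multinom n [k1, k2, k3] * 2^k1 * tetU k1 * small_t k2 * tetT k3) = 563 * Phi (p 2 * (e2 * e1))"
    unfolding Phi_linear(4)[symmetric] mult.assoc[of "fps_const _", symmetric]
    unfolding U[symmetric] st[symmetric] T[symmetric] Phi_def egf_nth_multinomial by (simp only: mult.assoc)
  have s_UTTT: "(\<Sum>(k1, k2, k3, k4) \<in> {(k1, k2, k3, k4). k1 + k2 + k3 + k4 = n}.
         multinom n [k1, k2, k3, k4] * 2^k1 * tetU k1 * tetT k2 * tetT k3 * tetT k4)
      = 563 * Phi (p 2 * (e1 * (e1 * e1)))"
    unfolding Phi_linear(4)[symmetric] mult.assoc[of "fps_const _", symmetric]
    unfolding U[symmetric] T[symmetric] Phi_def egf_nth_multinomial by (simp only: mult.assoc)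
  have s_tTTT: "(\<Sum>(k1, k2, k3, k4) \<in> {(k1, k2, k3, k4). k1 + k2 + k3 + k4 = n}.
         multinom n [k1, k2, k3, k4] * small_t k1 * tetT k2 * tetT k3 * tetT k4)
      = Phi (e2 * (e1 * (e1 * e1)))"
    unfolding Phi_def st[symmetric] T[symmetric] egf_nth_multinomial by (simp only: mult.assoc)
  have s_t4: "t_four lam n = Phi (t 2)"
    unfolding Phi_def t4[symmetric] by simp

  note sums = s_TTTTT s_WT s_T1 s_t1T s_VU s_Vt s_YU s_Yt s_VTT s_YTT s_UUT s_ttT s_UtT s_UTTT s_tTTT s_t4
  have X': "A / 563^2 * 5^n * tetX n = A / 563^2 * (563^2 * Phi (p 5))"
    unfolding s_X[symmetric] by (simp only: mult.assoc)
  note ids = quintic_symmetric_identities[OF p_def e1_def e2_def e3_def e4_def t_def]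
  \<comment> \<open>the powers of 563 in the statement undo the normalisation of the sequences\<close>
  have cancel: "x / 563^2 * (563^2 * z) = x * z" "x / 563^2 * (- (563^2) * z) = - (x * z)"
    "x / 563 * (563 * z) = x * z" "x / 563 * (- 563 * z) = - (x * z)" for x z :: complex
    by simp_all
  show ?thesis
    unfolding X'
    unfolding sums cancel ids Phi_linear A D E F H K
    by (simp add: algebra_simps)
qed

end
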